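(* Let $n\ge 1$. If a deterministic matching mechanism for $n$ agents and $n$ items is serializable, then its worst-case distortion is at least $2^n-1$.
   Context: Agents $A=\{a_1,\dots,a_n\}$ and items $B=\{b_1,\dots,b_n\}$. A metric is a function $d:(A\cup B)\times(A\cup B)\to\mathbb{R}_{\ge 0}$ with $d(x,x)=0$, $d(x,y)=d(y,x)$ and $d(x,y)\le d(x,z)+d(z,y)$ (distinct points are allowed to be at distance $0$). An ordinal matching problem instance consists of $n$ preference lists, one per agent; each list is a permutation of $B$. Agent $a_i$ prefers $b_j$ over $b_k$ if $b_j$ appears before $b_k$ in the list of $a_i$. A metric $d$ is consistent with the instance if, whenever $a_i$ prefers $b_j$ over $b_k$, we have $d(a_i,b_j)\le d(a_i,b_k)$ (each list is in increasing order of distance, ties broken arbitrarily). A perfect matching is a bijection $M:A\to B$, $\mathrm{cost}_d(M)=\sum_{i=1}^n d(a_i,M(a_i))$, and $M_{\mathrm{OPT}}$ denotes a minimum-cost perfect matching with respect to $d$. A deterministic matching mechanism is a function mapping each instance (preference lists only) to a perfect matching. Its worst-case distortion is the supremum, over all instances and all metrics $d$ consistent with the instance (with $\mathrm{cost}_d(M_{\mathrm{OPT}})>0$), of $\mathrm{cost}_d(M)/\mathrm{cost}_d(M_{\mathrm{OPT}})$, where $M$ is the output of the mechanism on the instance. A deterministic mechanism is serializable if there exist permutations $\pi$ and $\sigma$ of $[n]$ with the following property: whenever the mechanism is given an instance where, for each $1\le i<j\le n$, $a_{\pi(i)}$ prefers $b_{\sigma(i)}$ over $b_{\sigma(j)}$,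 it matches $a_{\pi(i)}$ to $b_{\sigma(i)}$ for all $i\in[n]$. *)

theory Defs
  imports
    Complex_Main
    "HOL-Library.FuncSet"
    "HOL-Library.Extended_Real"
    "HOL-Combinatorics.Multiset_Permutations"
begin

text \<open>
  Agents and items are both indexed by \<open>{1..n}\<close>.  A preference list over the items is a
  \<open>nat list\<close>, most preferred item first; an instance assigns such a list to every agent index,
  and is extensional, so that it carries no information beyond the \<open>n\<close> lists.
\<close>

type_synonym matching_instance = "nat \<Rightarrow> nat list"

definition instances :: "nat \<Rightarrow> matching_instance set" where
  "instances n = {1..n} \<rightarrow>\<^sub>E permutations_of_set {1..n}"

definition prefers :: "matching_instance \<Rightarrow> nat \<Rightarrow> nat \<Rightarrow> nat \<Rightarrow> bool" where
  "prefers P i j k \<longleftrightarrow> (\<exists>p q. p < q \<and> q < length (P i) \<and> P i ! p = j \<and> P i ! q = k)"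

datatype point = Agent nat | Item nat

definition points :: "nat \<Rightarrow> point set" where
  "points n = Agent ` {1..n} \<union> Item ` {1..n}"

text \<open>
  Distinct points may be at distance \<open>0\<close>, so this is not the library's \<open>Metric_space\<close>.
  Only the values of \<open>d\<close> on \<open>points n\<close> matter.
\<close>

definition is_metric :: "nat \<Rightarrow> (point \<Rightarrow> point \<Rightarrow> real) \<Rightarrow> bool" where
  "is_metric n d \<longleftrightarrow>
     (\<forall>x\<in>points n. \<forall>y\<in>points n. 0 \<le> d x y) \<and>
     (\<forall>x\<in>points n. d x x = 0) \<and>
     (\<forall>x\<in>points n. \<forall>y\<in>points n. d x y = d y x) \<and>
     (\<forall>x\<in>points n. \<forall>y\<in>points n. \<forall>z\<in>points n. d x y \<le> d x z + d z y)"

definition consistent :: "nat \<Rightarrow> matching_instance \<Rightarrow> (point \<Rightarrow> point \<Rightarrow> real) \<Rightarrow> bool" where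
  "consistent n P d \<longleftrightarrow>
     (\<forall>i\<in>{1..n}. \<forall>j\<in>{1..n}. \<forall>k\<in>{1..n}.
        prefers P i j k \<longrightarrow> d (Agent i) (Item j) \<le> d (Agent i) (Item k))"

text \<open>A matching is a map on indices: \<open>M i = j\<close> means that agent \<open>i\<close> receives item \<open>j\<close>.\<close>

definition perfect_matching :: "nat \<Rightarrow> (nat \<Rightarrow> nat) \<Rightarrow> bool" where
  "perfect_matching n M \<longleftrightarrow> bij_betw M {1..n} {1..n}"

definition cost :: "nat \<Rightarrow> (point \<Rightarrow> point \<Rightarrow> real) \<Rightarrow> (nat \<Rightarrow> nat) \<Rightarrow> real" where
  "cost n d M = (\<Sum>i=1..n. d (Agent i) (Item (M i)))"

definition min_cost_matching ::
  "nat \<Rightarrow> (point \<Rightarrow> point \<Rightarrow> real) \<Rightarrow> (nat \<Rightarrow> nat) \<Rightarrow> bool" where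
  "min_cost_matching n d M \<longleftrightarrow> is_arg_min (cost n d) (perfect_matching n) M"

definition matching_mechanism :: "nat \<Rightarrow> (matching_instance \<Rightarrow> nat \<Rightarrow> nat) \<Rightarrow> bool" where
  "matching_mechanism n F \<longleftrightarrow> (\<forall>P\<in>instances n. perfect_matching n (F P))"

text \<open>The supremum is taken in the extended reals, since the ratios may be unbounded.\<close>

definition worst_case_distortion :: "nat \<Rightarrow> (matching_instance \<Rightarrow> nat \<Rightarrow> nat) \<Rightarrow> ereal" where
  "worst_case_distortion n F =
     Sup {ereal (cost n d (F P) / cost n d M_OPT) | P d M_OPT.
            P \<in> instances n \<and> is_metric n d \<and> consistent n P d \<and>
            min_cost_matching n d M_OPT \<and> cost n d M_OPT > 0}"

definition serializable :: "nat \<Rightarrow> (matching_instance \<Rightarrow> nat \<Rightarrow> nat) \<Rightarrow> bool" where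
  "serializable n F \<longleftrightarrow>
     (\<exists>\<pi> \<sigma>. \<pi> permutes {1..n} \<and> \<sigma> permutes {1..n} \<and>
        (\<forall>P\<in>instances n.
           (\<forall>i j. 1 \<le> i \<and> i < j \<and> j \<le> n \<longrightarrow> prefers P (\<pi> i) (\<sigma> i) (\<sigma> j)) \<longrightarrow>
           (\<forall>i\<in>{1..n}. F P (\<pi> i) = \<sigma> i)))"

end

(* On a line put a_i at 2^(i-1) - 1 and b_i at 2^i - 1 for i < n, but b_n at -1. Then b_i and b_n are
   both at distance 2^(i-1) from a_i, and no b_j with i < j is closer, so breaking this tie in favour
   of b_i forces the matching a_i -> b_i of cost 1 + 2 + ... + 2^(n-1). Matching a_1 to b_n and every
   other a_i to b_(i-1), which lies at the same place, costs only 1. Nothing is cheaper, since b_n is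
   at distance at least 1 from every agent. *)

theory Submission
  imports Defs
begin

text \<open>\<open>pos\<close> need not be injective: zero distances between distinct points are
  allowed, and the construction relies on agents and items sharing a place.\<close>

lemma is_metric_line: "is_metric n (\<lambda>x y. \<bar>pos x - pos y\<bar>)"
  unfolding is_metric_def by auto

text \<open>Sort the elements with value strictly below \<open>f x\<close> into \<open>l\<close> and
  all others except \<open>x\<close> into \<open>r\<close>. Putting \<open>x\<close> between them
  keeps the list sorted and wins every tie for \<open>x\<close>.\<close>

lemma exists_sorted_list_first_among_ties:
  fixes f :: "'a \<Rightarrow> 'b::linorder"
  assumes "finite S" and "x \<in> S"
  shows "\<exists>l r. l @ x # r \<in> permutations_of_set S \<and> sorted (map f (l @ x # r)) \<and>
           (\<forall>y\<in>S. y \<noteq> x \<and> f x \<le> f y \<longrightarrow> y \<in> set r)"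
proof -
  have sorted_list: "\<exists>xs. set xs = T \<and> distinct xs \<and> sorted (map f xs)" if "finite T" for T
  proof -
    obtain ys where "set ys = T" "distinct ys"
      using finite_distinct_list[OF \<open>finite T\<close>] by blast
    then show ?thesis by (intro exI[of _ "sort_key f ys"]) simp
  qed
  obtain l where l: "set l = {y\<in>S. f y < f x}" "distinct l" "sorted (map f l)"
    using sorted_list[of "{y\<in>S. f y < f x}"] assms by auto
  obtain r where r: "set r = {y\<in>S. f x \<le> f y \<and> y \<noteq> x}" "distinct r" "sorted (map f r)"
    using sorted_list[of "{y\<in>S. f x \<le> f y \<and> y \<noteq> x}"] assms by auto
  have "set (l @ x # r) = S"
    using assms(2) by (auto simp: l(1) r(1))
  moreover have "distinct (l @ x # r)"
    using l(2) r(2) by (auto simp: l(1) r(1))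
  moreover have "sorted (map f (l @ x # r))"
    unfolding map_append list.map sorted_append sorted_simps using l(3) r(3) by (auto simp: l(1) r(1))
  ultimately show ?thesis
    by (intro exI[of _ l] exI[of _ r] conjI permutations_of_setI) (simp_all add: r(1))
qed

lemma prefers_sorted_imp_le:
  assumes "prefers P i j k" and "sorted (map f (P i))"
  shows "f j \<le> f k"
proof -
  obtain p q where pq: "p < q" "q < length (P i)" "P i ! p = j" "P i ! q = k"
    using assms(1) unfolding prefers_def by blast
  show ?thesis using sorted_nth_mono[OF assms(2), of p q] pq by simp
qed

lemma prefers_append_Cons:
  assumes "P i = l @ j # r" and "k \<in> set r"
  shows "prefers P i j k"
proof -
  obtain m where m: "m < length r" "r ! m = k" using assms(2) by (auto simp: in_set_conv_nth)
  \<comment> \<open>The prefix \<open>l\<close> and the entry \<open>j\<close> itself shift index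
    \<open>m\<close> of \<open>r\<close> to \<open>length l + Suc m\<close>.\<close>
  show ?thesis unfolding prefers_def
    by (rule exI[of _ "length l"], rule exI[of _ "length l + Suc m"])
      (use assms m in \<open>simp add: nth_append\<close>)
qed

text \<open>This gives control over tie-breaking: each agent \<open>i\<close> names one item
  \<open>g i\<close>, and a single consistent instance resolves all ties of all agents in favour of
  the named items.\<close>

lemma exists_consistent_instance:
  assumes "\<And>i. i \<in> {1..n} \<Longrightarrow> g i \<in> {1..n}"
  shows "\<exists>P\<in>instances n. consistent n P d \<and>
    (\<forall>i\<in>{1..n}. \<forall>k\<in>{1..n}. k \<noteq> g i \<and> d (Agent i) (Item (g i)) \<le> d (Agent i) (Item k)
        \<longrightarrow> prefers P i (g i) k)"
proof -
  let ?f = "\<lambda>i k. d (Agent i) (Item k)"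
  have "\<forall>i\<in>{1..n}. \<exists>l r. l @ g i # r \<in> permutations_of_set {1..n} \<and>
          sorted (map (?f i) (l @ g i # r)) \<and>
          (\<forall>k\<in>{1..n}. k \<noteq> g i \<and> ?f i (g i) \<le> ?f i k \<longrightarrow> k \<in> set r)"
    by (intro ballI exists_sorted_list_first_among_ties finite_atLeastAtMost assms)
  then obtain l r where lr: "\<forall>i\<in>{1..n}. l i @ g i # r i \<in> permutations_of_set {1..n} \<and>
          sorted (map (?f i) (l i @ g i # r i)) \<and>
          (\<forall>k\<in>{1..n}. k \<noteq> g i \<and> ?f i (g i) \<le> ?f i k \<longrightarrow> k \<in> set (r i))"
    unfolding bchoice_iff by (elim exE) rule
  \<comment> \<open>The restricted abstraction makes \<open>P\<close> extensional, as membership in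
    \<open>instances n\<close> demands.\<close>
  define P where "P = (\<lambda>i\<in>{1..n}. l i @ g i # r i)"
  have P: "P i = l i @ g i # r i" if "i \<in> {1..n}" for i
    using that by (simp add: P_def)
  have "P \<in> instances n"
    unfolding instances_def P_def restrict_PiE_iff using lr by simp
  moreover have "consistent n P d"
    unfolding consistent_def
  proof (intro ballI impI)
    fix i j k assume "i \<in> {1..n}" and pref: "prefers P i j k"
    then have "sorted (map (?f i) (P i))" using lr P by simp
    then show "?f i j \<le> ?f i k" by (rule prefers_sorted_imp_le[OF pref])
  qed
  moreover have "\<forall>i\<in>{1..n}. \<forall>k\<in>{1..n}. k \<noteq> g i \<and> ?f i (g i) \<le> ?f i k \<longrightarrow> prefers P i (g i) k"
  proof (intro ballI impI)
    fix i k assume "i \<in> {1..n}" "k \<in> {1..n}" "k \<noteq> g i \<and> ?f i (g i) \<le> ?f i k"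
    then show "prefers P i (g i) k" using lr by (intro prefers_append_Cons[OF P]) simp_all
  qed
  ultimately show ?thesis by (intro bexI[of _ P] conjI)
qed

lemma cost_permute:
  assumes "\<pi> permutes {1..n}"
  shows "cost n d M = (\<Sum>i=1..n. d (Agent (\<pi> i)) (Item (M (\<pi> i))))"
  unfolding cost_def using sum.permute[OF assms, of "\<lambda>i. d (Agent i) (Item (M i))"]
  by (simp add: comp_def)

definition agent_pos :: "nat \<Rightarrow> real" where
  "agent_pos i = 2 ^ (i - 1) - 1"

definition item_pos :: "nat \<Rightarrow> nat \<Rightarrow> real" where
  "item_pos n i = (if i = n then - 1 else 2 ^ i - 1)"

lemma agent_pos_nonneg: "0 \<le> agent_pos i"
  by (simp add: agent_pos_def)

text \<open>The case \<open>i = n\<close> gives the same value because -1 is the mirror image of 2^n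
  - 1 about \<open>agent_pos n\<close>.\<close>

lemma dist_agent_own_item:
  assumes "i \<ge> 1"
  shows "\<bar>agent_pos i - item_pos n i\<bar> = 2 ^ (i - 1)"
proof -
  have "(2::real) ^ i = 2 * 2 ^ (i - 1)" using assms by (cases i) auto
  then show ?thesis by (simp add: agent_pos_def item_pos_def)
qed

text \<open>For \<open>j = n\<close> this is an exact tie. Otherwise item \<open>j\<close> stands at
  2^j - 1, no further left than 2^i - 1, which is already 2^(i-1) to the right of agent
  \<open>i\<close>.\<close>

lemma dist_agent_own_item_le:
  assumes "i \<ge> 1" and "i < j"
  shows "\<bar>agent_pos i - item_pos n i\<bar> \<le> \<bar>agent_pos i - item_pos n j\<bar>"
proof (cases "j = n")
  case True
  have "\<bar>agent_pos i - item_pos n j\<bar> = 2 ^ (i - 1)"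
    using True by (simp add: agent_pos_def item_pos_def)
  then show ?thesis using dist_agent_own_item[OF assms(1)] by simp
next
  case False
  have "(2::real) * 2 ^ (i - 1) = 2 ^ i" using assms by (cases i) auto
  also have "\<dots> \<le> 2 ^ j" using assms by (intro power_increasing) auto
  finally have "2 ^ (i - 1) \<le> \<bar>agent_pos i - item_pos n j\<bar>"
    using False by (simp add: agent_pos_def item_pos_def)
  then show ?thesis using dist_agent_own_item[OF assms(1)] by simp
qed

lemma sum_dist_agent_own_item:
  "(\<Sum>i=1..n. \<bar>agent_pos i - item_pos n i\<bar>) = 2 ^ n - 1"
proof -
  have "(\<Sum>i=1..n. \<bar>agent_pos i - item_pos n i\<bar>) = (\<Sum>i=1..n. 2 ^ (i - 1))"
    by (intro sum.cong) (auto simp: dist_agent_own_item)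
  also have "\<dots> = (\<Sum>i<n. 2 ^ i)"
    by (simp add: sum.atLeast1_atMost_eq)
  also have "\<dots> = 2 ^ n - 1" by (induction n) auto
  finally show ?thesis .
qed

text \<open>This is the cheap matching before relabelling. For \<open>n = 1\<close> it is the
  identity on the only index, and both matchings cost 1.\<close>

definition cyclic_pred :: "nat \<Rightarrow> nat \<Rightarrow> nat" where
  "cyclic_pred n i = (if i = 1 then n else i - 1)"

lemma bij_betw_cyclic_pred: "bij_betw (cyclic_pred n) {1..n} {1..n}"
  by (rule bij_betw_byWitness[where f' = "\<lambda>i. if i = n then 1 else i + 1"])
    (auto simp: cyclic_pred_def)

lemma sum_dist_agent_cyclic_pred:
  assumes "n \<ge> 1"
  shows "(\<Sum>i=1..n. \<bar>agent_pos i - item_pos n (cyclic_pred n i)\<bar>) = 1"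
proof -
  have "(\<Sum>i=1..n. \<bar>agent_pos i - item_pos n (cyclic_pred n i)\<bar>) = (\<Sum>i=1..n. if i = 1 then 1 else 0)"
    by (intro sum.cong) (auto simp: agent_pos_def item_pos_def cyclic_pred_def)
  then show ?thesis using assms by simp
qed

theorem mainTheorem3:
  fixes n :: nat and F :: "matching_instance \<Rightarrow> nat \<Rightarrow> nat"
  assumes "n \<ge> 1"
    and "matching_mechanism n F"
    and "serializable n F"
  shows "worst_case_distortion n F \<ge> ereal (2 ^ n - 1)"
proof -
  obtain \<pi> \<sigma> where \<pi>: "\<pi> permutes {1..n}" and \<sigma>: "\<sigma> permutes {1..n}"
    and F: "\<And>P. P \<in> instances n \<Longrightarrow>
           \<forall>i j. 1 \<le> i \<and> i < j \<and> j \<le> n \<longrightarrow> prefers P (\<pi> i) (\<sigma> i) (\<sigma> j) \<Longrightarrow>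
           \<forall>i\<in>{1..n}. F P (\<pi> i) = \<sigma> i"
    using assms(3) unfolding serializable_def by blast
  note [simp] = permutes_inverses[OF \<pi>] permutes_inverses[OF \<sigma>]
  have \<pi>_in: "\<pi> i \<in> {1..n} \<longleftrightarrow> i \<in> {1..n}" and \<sigma>_in: "\<sigma> i \<in> {1..n} \<longleftrightarrow> i \<in> {1..n}"
    and inv_\<pi>_in: "inv \<pi> i \<in> {1..n} \<longleftrightarrow> i \<in> {1..n}" for i
    using permutes_in_image \<pi> \<sigma> permutes_inv by metis+
  \<comment> \<open>Relabelling: agent \<open>\<pi> i\<close> stands at \<open>agent_pos i\<close>
    and item \<open>\<sigma> j\<close> at \<open>item_pos n j\<close>, so the order along the line
    is the serial order of the mechanism.\<close>
  define pos where "pos x = (case x of Agent i \<Rightarrow> agent_pos (inv \<pi> i)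
                                     | Item j \<Rightarrow> item_pos n (inv \<sigma> j))" for x
  define d where "d x y = \<bar>pos x - pos y\<bar>" for x y
  have d_perm: "d (Agent (\<pi> i)) (Item (\<sigma> j)) = \<bar>agent_pos i - item_pos n j\<bar>" for i j
    by (simp add: d_def pos_def)
  have metric: "is_metric n d"
    unfolding d_def by (rule is_metric_line)
  have "\<sigma> (inv \<pi> i) \<in> {1..n}" if "i \<in> {1..n}" for i
    using that \<sigma>_in inv_\<pi>_in by blast
  \<comment> \<open>With this choice of \<open>g\<close>, agent \<open>\<pi> i\<close> favours item
    \<open>\<sigma> i\<close> in every tie, which is what the premise of serializability needs at
    \<open>j = n\<close>.\<close>
  from exists_consistent_instance[of n "\<lambda>i. \<sigma> (inv \<pi> i)" d, OF this]
  obtain P where P: "P \<in> instances n" "consistent n P d"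
    and ties: "\<And>i k. i \<in> {1..n} \<Longrightarrow> k \<in> {1..n} \<Longrightarrow> k \<noteq> \<sigma> (inv \<pi> i) \<Longrightarrow>
        d (Agent i) (Item (\<sigma> (inv \<pi> i))) \<le> d (Agent i) (Item k) \<Longrightarrow> prefers P i (\<sigma> (inv \<pi> i)) k"
    by blast
  have "prefers P (\<pi> i) (\<sigma> i) (\<sigma> j)" if "1 \<le> i" "i < j" "j \<le> n" for i j
  proof -
    have "\<sigma> j \<noteq> \<sigma> i" using permutes_inj[OF \<sigma>] that by (auto dest: injD)
    moreover have "\<pi> i \<in> {1..n}" "\<sigma> j \<in> {1..n}" unfolding \<pi>_in \<sigma>_in using that by auto
    ultimately show ?thesis
      using ties[of "\<pi> i" "\<sigma> j"] dist_agent_own_item_le[OF that(1,2)] by (simp add: d_perm)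
  qed
  then have FP: "\<forall>i\<in>{1..n}. F P (\<pi> i) = \<sigma> i"
    using F[OF P(1)] by blast
  have cost_F: "cost n d (F P) = 2 ^ n - 1"
    unfolding cost_permute[OF \<pi>] using FP sum_dist_agent_own_item by (simp add: d_perm)

  \<comment> \<open>Agent \<open>\<pi> i\<close> receives item
    \<open>\<sigma> (cyclic_pred n i)\<close>.\<close>
  define M where "M = \<sigma> \<circ> cyclic_pred n \<circ> inv \<pi>"
  have cost_M: "cost n d M = 1"
    unfolding cost_permute[OF \<pi>]
    using sum_dist_agent_cyclic_pred[OF assms(1)] by (simp add: M_def d_perm)
  have "perfect_matching n M"
    unfolding perfect_matching_def M_def
    by (intro bij_betw_trans[OF permutes_imp_bij[OF permutes_inv[OF \<pi>]]]
        bij_betw_trans[OF bij_betw_cyclic_pred] permutes_imp_bij[OF \<sigma>])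
  \<comment> \<open>By surjectivity some agent receives \<open>\<sigma> n\<close>, the item at -1,
    while all agents stand at nonnegative positions. That one summand already bounds the
    cost.\<close>
  moreover have "1 \<le> cost n d M'" if "perfect_matching n M'" for M'
  proof -
    have "\<sigma> n \<in> {1..n}" unfolding \<sigma>_in using assms(1) by simp
    also have "{1..n} = M' ` {1..n}"
      using that by (simp add: perfect_matching_def bij_betw_imp_surj_on)
    finally obtain a where a: "a \<in> {1..n}" "M' a = \<sigma> n" by (metis imageE)
    have "1 \<le> d (Agent a) (Item (M' a))"
      using agent_pos_nonneg[of "inv \<pi> a"] a by (simp add: d_def pos_def item_pos_def)
    also have "\<dots> \<le> cost n d M'"
      unfolding cost_def by (rule member_le_sum) (use a in \<open>auto simp: d_def\<close>)
    finally show ?thesis .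
  qed
  ultimately have "min_cost_matching n d M"
    unfolding min_cost_matching_def is_arg_min_linorder using cost_M by simp
  \<comment> \<open>Since the optimum costs exactly 1, the ratio is the cost of \<open>F P\<close>
    itself, and this single member bounds the supremum from below.\<close>
  then have "ereal (2 ^ n - 1) \<in> {ereal (cost n d (F P) / cost n d M_OPT) | P d M_OPT.
            P \<in> instances n \<and> is_metric n d \<and> consistent n P d \<and>
            min_cost_matching n d M_OPT \<and> cost n d M_OPT > 0}"
    using P metric cost_F cost_M
    by (intro CollectI exI[of _ P] exI[of _ d] exI[of _ M]) simp
  then show ?thesis
    unfolding worst_case_distortion_def by (rule Sup_upper)
qed

end
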